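(* Let $p=(\tau,R)$ and $q=(\tau,R')$ be mesh patterns with the same underlying permutation $\tau$, and let $d\ge 0$ be an integer (the depth). If the Shading Algorithm with input $p,q,F,d$ (that is, the call $\mathrm{SA}(p,\tau,F,d)$) returns Success for some choice of a force $F$ on $p$, then an occurrence of $p$ implies an occurrence of $q$, i.e. every permutation that contains $p$ also contains $q$.
   Context: Permutations, mesh patterns. A permutation $\pi\in S_n$ is a bijection of $\{1,\dots,n\}$, written as the word $\pi(1)\cdots\pi(n)$; its points are $(x,\pi(x))$. A mesh pattern is a pair $p=(\tau,R)$ with $\tau\in S_k$ and $R\subseteq\{0,\dots,k\}^2$; $(a,b)\in R$ stands for the shaded unit square $[a,a+1]\times[b,b+1]$. Its size is $k$. Occurrences. Let $\sigma\in S_n$, $\tau\in S_k$. An occurrence of the classical pattern $\tau$ in $\sigma$ is a subsequence $c=\sigma(u_1)\cdots\sigma(u_k)$, $u_1<\dots<u_k$, order isomorphic to $\tau$. Let $v_1<\dots<v_k$ be its values sorted, $u_0=v_0=0$, $u_{k+1}=v_{k+1}=n+1$. The region of a square $(a,b)\in\{0,\dots,k\}^2$ with respect to $c$ is $(u_a,u_{a+1})\times(v_b,v_{b+1})$; the unit squares corresponding to $(a,b)$ are the $(x,y)$ with $u_a\le x<u_{a+1}$, $v_b\le y<v_{b+1}$. The subsequence $c$ is an occurrence of the mesh pattern $(\tau,R)$ in the permutation $\sigma$ if for each $(a,b)\in R$ its region contains no point of $\sigma$; it is an occurrence of $(\tau,R)$ in the mesh pattern $(\sigma,Y)$ if in addition,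 for each $(a,b)\in R$, all unit squares corresponding to $(a,b)$ belong to $Y$. "Contains" means having an occurrence. Adding a point. For $p=(\tau,R)$, $\tau\in S_k$, and an unshaded square $(i,j)\in\{0,\dots,k\}^2\setminus R$, let $\tau'\in S_{k+1}$ be obtained by inserting a new point at position $i+1$ with value $j+1$ (points of $\tau$ at positions $>i$ move one to the right, values $>j$ increase by one), and let $T'$ be the set of $(a,b)\in\{0,\dots,k+1\}^2$ with $(\phi_i(a),\phi_j(b))\in R$, where $\phi_i(a)=a$ if $a\le i$ and $\phi_i(a)=a-1$ if $a>i$. Put $p^{(i,j)\uparrow}=(\tau',T'\cup\{(i,j+1),(i+1,j+1)\})$, $p^{(i,j)\downarrow}=(\tau',T'\cup\{(i,j),(i+1,j)\})$, $p^{(i,j)\leftarrow}=(\tau',T'\cup\{(i,j),(i,j+1)\})$, $p^{(i,j)\rightarrow}=(\tau',T'\cup\{(i+1,j),(i+1,j+1)\})$. Forces. A force on a mesh pattern with underlying $\tau\in S_k$ is a tuple $F=((\tau(i_1),a_1),\dots,(\tau(i_\ell),a_\ell))$ with $0\le\ell\le k$, distinct $i_j\in\{1,\dots,k\}$ and $a_j\in\{\uparrow,\downarrow,\leftarrow,\rightarrow\}$. If $c=c_1\cdots c_k$ is an occurrence of $\tau$ in a permutation $\sigma$, or in a mesh pattern with underlying permutation $\sigma$, its strength $\mathrm{strength}_F(c)$ is the $\ell$-tuple whose $j$-th entry is $c_{i_j}$, $-c_{i_j}$, $-\sigma^{-1}(c_{i_j})$, $\sigma^{-1}(c_{i_j})$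 when $a_j$ is $\uparrow,\downarrow,\leftarrow,\rightarrow$ respectively. Strengths are compared lexicographically. The Shading Algorithm. Fix $p=(\tau,R)$, $q=(\tau,R')$, $F$. For a square $s=(x,y)$, $\mathrm{UpdO}(c,s)$ replaces each entry $c_i>y$ of $c$ by $c_i+1$ and leaves the other entries unchanged, and $\mathrm{UpdF}(F',s)$ does the same to the values occurring in the force $F'$ (so that they refer to the same points after a point is inserted into $s$). The recursive function $\mathrm{SA}(w,c,F',d)$ takes a mesh pattern $w=(\sigma,Y)$, an occurrence $c$ of $p$ in $w$, a force $F'$ on $w$ and an integer $d\ge 0$, and is defined as follows. For each occurrence $c'$ of the classical pattern $\tau$ in $w$ (i.e. in $\sigma$): (i) let $T$ be the maximal shading such that $c'$ is an occurrence of $(\tau,T)$ in $w$; (ii) if $R\subseteq T$ and $\mathrm{strength}_F(c')>\mathrm{strength}_F(c)$, return Success; (iii) if $R'\subseteq T$, return Success; (iv) if $d>0$: let $s_1,\dots,s_m$ be the unit squares in $w$ that correspond (with respect to $c'$) to the squares in $R'\setminus T$ (only unshaded ones, i.e. not in $Y$, since adding a point is defined only for unshaded squares); if for every $i\in\{1,\dots,m\}$ there is $a\in\{\uparrow,\downarrow,\leftarrow,\rightarrow\}$ such that $\mathrm{SA}\big((\sigma,Y\cup\{s_1,\dots,s_{i-1}\})^{s_i a},\mathrm{UpdO}(c,s_i),\mathrm{UpdF}(F',s_i),d-1\big)$ returns Success, then return Success. If no $c'$ led to Success, return Failure. The Shading Algorithm on input $p,q,F,d$ is the call $\mathrm{S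A}(p,\tau,F,d)$.
   Formalization: Step (iv) of SA is applied only to c' for which no region of a square in R'∖T contains a point of σ; without this the claim is false (τ=123, d=2, empty force: 13425 contains p but avoids q). The squares s_1,…,s_m may be taken in any order. *)

theory Defs
  imports "HOL-Combinatorics.Multiset_Permutations" "HOL-Library.Sublist"
begin

text \<open>
  A permutation of \<open>{1..n}\<close> is represented by its word, an element of
  \<^term>\<open>permutations_of_set {1..n::nat}\<close>; list indices start at 0, positions at 1.
\<close>

type_synonym square = "nat \<times> nat"
type_synonym mesh = "nat list \<times> square set"

definition grid :: "nat \<Rightarrow> square set" where
  "grid k = {0..k} \<times> {0..k}"

definition mesh_pattern :: "mesh \<Rightarrow> bool" where
  "mesh_pattern = (\<lambda>(\<tau>, R).
     \<tau> \<in> permutations_of_set {1..length \<tau>} \<and> R \<subseteq> grid (length \<tau>))"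

definition points :: "nat list \<Rightarrow> (nat \<times> nat) set" where
  "points \<sigma> = {(x, \<sigma> ! (x - 1)) | x. x \<in> {1..length \<sigma>}}"

text \<open>\<open>pos \<sigma> v\<close> is \<open>\<sigma>\<^sup>-\<^sup>1(v)\<close>.\<close>

definition pos :: "nat list \<Rightarrow> nat \<Rightarrow> nat" where
  "pos \<sigma> v = (THE x. (x, v) \<in> points \<sigma>)"

definition order_isomorphic :: "nat list \<Rightarrow> nat list \<Rightarrow> bool" where
  "order_isomorphic c \<tau> \<longleftrightarrow> length c = length \<tau> \<and>
     (\<forall>i<length \<tau>. \<forall>j<length \<tau>. c ! i < c ! j \<longleftrightarrow> \<tau> ! i < \<tau> ! j)"

definition classical_occ :: "nat list \<Rightarrow> nat list \<Rightarrow> nat list \<Rightarrow> bool" where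
  "classical_occ \<tau> c \<sigma> \<longleftrightarrow> subseq c \<sigma> \<and> order_isomorphic c \<tau>"

text \<open>The lists \<open>u\<^sub>0, \<dots>, u\<^sub>k\<^sub>+\<^sub>1\<close> and \<open>v\<^sub>0, \<dots>, v\<^sub>k\<^sub>+\<^sub>1\<close> of an occurrence \<open>c\<close> in \<open>\<sigma>\<close>.\<close>

definition xlines :: "nat list \<Rightarrow> nat list \<Rightarrow> nat list" where
  "xlines \<sigma> c = 0 # map (pos \<sigma>) c @ [length \<sigma> + 1]"

definition ylines :: "nat list \<Rightarrow> nat list \<Rightarrow> nat list" where
  "ylines \<sigma> c = 0 # sort c @ [length \<sigma> + 1]"

definition region :: "nat list \<Rightarrow> nat list \<Rightarrow> square \<Rightarrow> (nat \<times> nat) set" where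
  "region \<sigma> c = (\<lambda>(a, b).
     {xlines \<sigma> c ! a <..< xlines \<sigma> c ! (a + 1)} \<times> {ylines \<sigma> c ! b <..< ylines \<sigma> c ! (b + 1)})"

definition unit_squares :: "nat list \<Rightarrow> nat list \<Rightarrow> square \<Rightarrow> square set" where
  "unit_squares \<sigma> c = (\<lambda>(a, b).
     {xlines \<sigma> c ! a ..< xlines \<sigma> c ! (a + 1)} \<times> {ylines \<sigma> c ! b ..< ylines \<sigma> c ! (b + 1)})"

definition occ_in_perm :: "mesh \<Rightarrow> nat list \<Rightarrow> nat list \<Rightarrow> bool" where
  "occ_in_perm = (\<lambda>(\<tau>, R) c \<sigma>.
     classical_occ \<tau> c \<sigma> \<and> (\<forall>s\<in>R. region \<sigma> c s \<inter> points \<sigma> = {}))"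

definition occ_in_mesh :: "mesh \<Rightarrow> nat list \<Rightarrow> mesh \<Rightarrow> bool" where
  "occ_in_mesh = (\<lambda>(\<tau>, R) c (\<sigma>, Y).
     occ_in_perm (\<tau>, R) c \<sigma> \<and> (\<forall>s\<in>R. unit_squares \<sigma> c s \<subseteq> Y))"

definition contains_mesh :: "nat list \<Rightarrow> mesh \<Rightarrow> bool" where
  "contains_mesh \<sigma> p \<longleftrightarrow> (\<exists>c. occ_in_perm p c \<sigma>)"

datatype dir = Upward | Downward | Leftward | Rightward

definition bump :: "nat \<Rightarrow> nat \<Rightarrow> nat" where
  "bump j v = (if v > j then v + 1 else v)"

definition collapse :: "nat \<Rightarrow> nat \<Rightarrow> nat" where
  "collapse i a = (if a \<le> i then a else a - 1)"

definition insert_point :: "nat list \<Rightarrow> square \<Rightarrow> nat list" where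
  "insert_point \<tau> = (\<lambda>(i, j). map (bump j) (take i \<tau>) @ [j + 1] @ map (bump j) (drop i \<tau>))"

definition dir_shading :: "square \<Rightarrow> dir \<Rightarrow> square set" where
  "dir_shading = (\<lambda>(i, j) a. case a of
      Upward \<Rightarrow> {(i, j + 1), (i + 1, j + 1)}
    | Downward \<Rightarrow> {(i, j), (i + 1, j)}
    | Leftward \<Rightarrow> {(i, j), (i, j + 1)}
    | Rightward \<Rightarrow> {(i + 1, j), (i + 1, j + 1)})"

text \<open>Only meaningful for unshaded squares \<open>s\<close>, and used only for these.\<close>

definition add_point :: "mesh \<Rightarrow> square \<Rightarrow> dir \<Rightarrow> mesh" where
  "add_point = (\<lambda>(\<tau>, R) s a.
     (insert_point \<tau> s,
      {(x, y) \<in> grid (length \<tau> + 1). (collapse (fst s) x, collapse (snd s) y) \<in> R}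
        \<union> dir_shading s a))"

type_synonym force = "(nat \<times> dir) list"

definition force_on :: "nat list \<Rightarrow> force \<Rightarrow> bool" where
  "force_on \<tau> F \<longleftrightarrow> distinct (map fst F) \<and> set (map fst F) \<subseteq> set \<tau>"

text \<open>
  The force \<open>F\<close> refers to values of \<open>\<tau>\<close>; the entry of \<open>c\<close> playing the role of the value \<open>v\<close> of
  \<open>\<tau>\<close> is the one with index \<open>\<tau>\<^sup>-\<^sup>1(v)\<close>.
\<close>

definition strength :: "nat list \<Rightarrow> force \<Rightarrow> nat list \<Rightarrow> nat list \<Rightarrow> int list" where
  "strength \<tau> F \<sigma> c = map (\<lambda>(v, a). let e = c ! (pos \<tau> v - 1) in
     case a of
       Upward \<Rightarrow> int e
     | Downward \<Rightarrow> - int e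
     | Leftward \<Rightarrow> - int (pos \<sigma> e)
     | Rightward \<Rightarrow> int (pos \<sigma> e)) F"

definition weaker :: "int list \<Rightarrow> int list \<Rightarrow> bool" where
  "weaker s t \<longleftrightarrow> (s, t) \<in> lexord {(x, y). x < y}"

definition max_shading :: "nat list \<Rightarrow> nat list \<Rightarrow> mesh \<Rightarrow> square set" where
  "max_shading \<tau> c w = (GREATEST T. T \<subseteq> grid (length \<tau>) \<and> occ_in_mesh (\<tau>, T) c w)"

definition UpdO :: "nat list \<Rightarrow> square \<Rightarrow> nat list" where
  "UpdO c s = map (bump (snd s)) c"

definition UpdF :: "force \<Rightarrow> square \<Rightarrow> force" where
  "UpdF F s = map (\<lambda>(v, a). (bump (snd s) v, a)) F"

datatype result = Success | Failure

text \<open>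
  The order in which the unit squares are processed is not specified informally; here any order
  \<open>ss\<close> may be used, so that success for some particular order implies success in this sense.
  Strengths refer to the original force \<open>F\<close>; the updated force \<open>F'\<close> is only carried along.

  The recursive step is restricted to occurrences \<open>c'\<close> for which no region of a square of \<open>R' - T\<close>
  contains a point of \<open>\<sigma>\<close>: if there is such a point, \<open>c'\<close> does not become an occurrence of
  \<open>(\<tau>, R')\<close> when all unit squares in \<open>ss\<close> are empty. The informal description does not state
  this condition, but without it the algorithm is unsound. For \<open>\<tau> = 123\<close>, \<open>R\<close> the complement
  of \<open>{(0,0), (2,0), (3,0)}\<close> in the grid,
  \<open>R' = {(0,0), (0,2), (0,3), (1,0), (1,2), (1,3), (2,1), (2,2), (2,3), (3,2), (3,3)}\<close>, the empty
  force and depth 2, adding a point to \<open>(0,0)\<close> downwards gives a mesh pattern on \<open>1234\<close> in which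
  \<open>c' = 123\<close> has \<open>R' - T = {(3,3)}\<close>, all unit squares of \<open>(3,3)\<close> are shaded, and \<open>ss\<close> is empty;
  but \<open>13425\<close> contains \<open>(\<tau>, R)\<close> and avoids \<open>(\<tau>, R')\<close>.
\<close>

fun SA :: "nat list \<Rightarrow> square set \<Rightarrow> square set \<Rightarrow> force \<Rightarrow>
    mesh \<Rightarrow> nat list \<Rightarrow> force \<Rightarrow> nat \<Rightarrow> result" where
  "SA \<tau> R R' F (\<sigma>, Y) c F' d =
    (if \<exists>c'. classical_occ \<tau> c' \<sigma> \<and>
         (let T = max_shading \<tau> c' (\<sigma>, Y) in
            R \<subseteq> T \<and> weaker (strength \<tau> F \<sigma> c) (strength \<tau> F \<sigma> c')
          \<or> R' \<subseteq> T
          \<or> (case d of 0 \<Rightarrow> False | Suc d' \<Rightarrow>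
               (\<forall>s\<in>R' - T. region \<sigma> c' s \<inter> points \<sigma> = {}) \<and>
               (\<exists>ss. distinct ss \<and> set ss = (\<Union>s\<in>R' - T. unit_squares \<sigma> c' s) - Y \<and>
                  (\<forall>i<length ss. \<exists>a.
                     SA \<tau> R R' F (add_point (\<sigma>, Y \<union> set (take i ss)) (ss ! i) a)
                       (UpdO c (ss ! i)) (UpdF F' (ss ! i)) d' = Success))))
     then Success else Failure)"

declare SA.simps [simp del]

definition shading_algorithm ::
    "nat list \<Rightarrow> square set \<Rightarrow> square set \<Rightarrow> force \<Rightarrow> nat \<Rightarrow> result" where
  "shading_algorithm \<tau> R R' F d = SA \<tau> R R' F (\<tau>, R) \<tau> F d"

end

theory Submission
  imports Defs
begin

text \<open>
  Suppose that \<open>\<pi>\<close> contains \<open>p = (\<tau>, R)\<close>. It has finitely many occurrences of \<open>p\<close>; let \<open>c0\<close> be one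
  whose strength with respect to the force \<open>F\<close> is maximal. A run of the algorithm is a case analysis
  on how \<open>\<pi>\<close> looks around \<open>c0\<close>: each pair \<open>(w, c)\<close> reached by the recursion describes a
  configuration, the mesh pattern \<open>w\<close>, that is known to occur in \<open>\<pi>\<close> in such a way that \<open>c\<close> lands on
  \<open>c0\<close>. The claim \<open>SA_sound\<close> is that whenever \<open>w = (\<sigma>, Y)\<close> occurs in \<open>\<pi>\<close> like this and
  the call succeeds, \<open>\<pi>\<close> contains \<open>q = (\<tau>, R')\<close>. It follows by induction on the depth.

  Let \<open>c'\<close> be the occurrence of \<open>\<tau>\<close> in \<open>\<sigma>\<close> responsible for the success, and \<open>T\<close> its maximal shading.
  Occurrences of mesh patterns compose (\<open>occ_in_mesh_embedding\<close>), so the image of \<open>c'\<close> in \<open>\<pi>\<close> is an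
  occurrence of \<open>(\<tau>, T)\<close>. There are three ways to succeed.

  \<^item> If \<open>R \<subseteq> T\<close> and \<open>c'\<close> is stronger than \<open>c\<close>, then the image of \<open>c'\<close> is an occurrence of \<open>p\<close> in \<open>\<pi>\<close>. It
    is stronger than \<open>c0\<close>, since an occurrence of \<open>\<sigma>\<close> preserves the order of positions and of values
    (\<open>weaker_strength_map\<close>). This contradicts the choice of \<open>c0\<close>.
  \<^item> If \<open>R' \<subseteq> T\<close>, then the image of \<open>c'\<close> is an occurrence of \<open>q\<close>.
  \<^item> Otherwise, the unit squares \<open>s\<^sub>1, \<dots>, s\<^sub>m\<close> are what separates \<open>c'\<close> from being an occurrence of \<open>q\<close>.
    If all of them are empty in \<open>\<pi>\<close>, then \<open>c'\<close> yields an occurrence of \<open>q\<close>. If not, let \<open>s\<^sub>i\<close> be the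
    first one that contains a point of \<open>\<pi>\<close>. The squares before it are empty and may be shaded. For
    whichever direction \<open>a\<close> the algorithm used, \<open>s\<^sub>i\<close> has a point that lies furthest in direction \<open>a\<close>,
    so the pattern with an added point occurs in \<open>\<pi>\<close>, with its new point at this extremal one
    (\<open>embedding_add_point\<close>). The induction hypothesis applies.
\<close>

section \<open>Permutation words and their points\<close>

abbreviation perm_word :: "nat list \<Rightarrow> bool" where
  "perm_word \<sigma> \<equiv> \<sigma> \<in> permutations_of_set {1..length \<sigma>}"

lemma perm_wordD:
  assumes "perm_word \<sigma>"
  shows "set \<sigma> = {1..length \<sigma>}" and "distinct \<sigma>"
  using assms by (auto simp: permutations_of_set_def)

lemma in_points_iff:
  "(x, y) \<in> points \<sigma> \<longleftrightarrow> 1 \<le> x \<and> x \<le> length \<sigma> \<and> y = \<sigma> ! (x - 1)"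
  by (auto simp: points_def)

lemma finite_points: "finite (points \<sigma>)"
proof -
  have "points \<sigma> = (\<lambda>x. (x, \<sigma> ! (x - 1))) ` {1..length \<sigma>}"
    by (auto simp: points_def)
  thus ?thesis by simp
qed

lemma nth_in_points: "i < length \<sigma> \<Longrightarrow> (Suc i, \<sigma> ! i) \<in> points \<sigma>"
  by (simp add: in_points_iff)

lemma points_range:
  assumes "perm_word \<sigma>" "(x, y) \<in> points \<sigma>"
  shows "1 \<le> x" "x \<le> length \<sigma>" "1 \<le> y" "y \<le> length \<sigma>"
proof -
  show x: "1 \<le> x" "x \<le> length \<sigma>"
    using assms(2) by (auto simp: in_points_iff)
  have "y \<in> set \<sigma>"
    using assms(2) x by (auto simp: in_points_iff)
  thus "1 \<le> y" "y \<le> length \<sigma>"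
    using perm_wordD[OF assms(1)] by auto
qed

lemma points_inj:
  assumes "perm_word \<sigma>" "(x, y) \<in> points \<sigma>" "(x', y) \<in> points \<sigma>"
  shows "x = x'"
proof -
  have "x - 1 = x' - 1"
    using assms perm_wordD(2)[OF assms(1)] by (auto simp: in_points_iff nth_eq_iff_index_eq)
  thus ?thesis using assms by (auto simp: in_points_iff)
qed

lemma pos_eq:
  assumes "perm_word \<sigma>" "(x, y) \<in> points \<sigma>"
  shows "pos \<sigma> y = x"
  unfolding pos_def using assms points_inj by blast

lemma pos_in_points:
  assumes "perm_word \<sigma>" "y \<in> set \<sigma>"
  shows "(pos \<sigma> y, y) \<in> points \<sigma>"
proof -
  obtain i where "i < length \<sigma>" "y = \<sigma> ! i"
    using assms(2) by (auto simp: in_set_conv_nth)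
  hence p: "(Suc i, y) \<in> points \<sigma>" by (simp add: nth_in_points)
  thus ?thesis using pos_eq[OF assms(1) p] by simp
qed

lemma sort_perm_word:
  assumes "perm_word \<sigma>"
  shows "sort \<sigma> = [1..<Suc (length \<sigma>)]"
proof (rule sorted_distinct_set_unique)
  show "set (sort \<sigma>) = set [1..<Suc (length \<sigma>)]"
    by (simp add: perm_wordD(1)[OF assms] atLeastLessThanSuc_atLeastAtMost del: upt_Suc)
qed (simp_all add: perm_wordD(2)[OF assms] del: upt_Suc)

lemma sort_map_mono:
  fixes f :: "nat \<Rightarrow> nat"
  assumes "\<And>x y. x \<in> set xs \<Longrightarrow> y \<in> set xs \<Longrightarrow> x \<le> y \<Longrightarrow> f x \<le> f y"
  shows "sort (map f xs) = map f (sort xs)"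
proof (rule properties_for_sort)
  show "mset (map f (sort xs)) = mset (map f xs)" by simp
  show "sorted (map f (sort xs))"
    unfolding sorted_map
    by (rule sorted_wrt_mono_rel[OF _ sorted_sort[of xs]]) (use assms in auto)
qed

lemma subseq_map_nth:
  assumes "sorted_wrt (<) js" "set js \<subseteq> {..<length xs}"
  shows "subseq (map ((!) xs) js) xs"
proof -
  have "subseq js [0..<length xs]"
    by (rule sorted_subset_imp_subseq) (use assms in auto)
  thus ?thesis using subseq_map[of js "[0..<length xs]" "(!) xs"] by (simp add: map_nth)
qed

lemma sorted_wrt_subseq:
  assumes "subseq xs ys" "sorted_wrt P ys"
  shows "sorted_wrt P xs"
  using assms by (induction rule: list_emb.induct) (auto dest: list_emb_set)

section \<open>Embeddings of one permutation in another\<close>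

text \<open>
  An occurrence of \<open>\<sigma>\<close> in \<open>\<pi>\<close> is given by where it sends the vertical grid lines (\<open>X\<close>) and the
  horizontal ones (\<open>V\<close>) of the diagram of \<open>\<sigma>\<close>. The border lines are included, so
  that every square of the grid has a pair of consecutive lines in both directions, and no case
  distinction at the boundary arises. In this form composing occurrences is composing functions.
\<close>

definition embedding :: "nat list \<Rightarrow> nat list \<Rightarrow> (nat \<Rightarrow> nat) \<Rightarrow> (nat \<Rightarrow> nat) \<Rightarrow> bool" where
  "embedding \<sigma> \<pi> X V \<longleftrightarrow>
     strict_mono_on {0..length \<sigma> + 1} X \<and> strict_mono_on {0..length \<sigma> + 1} V \<and>
     X 0 = 0 \<and> V 0 = 0 \<and> X (length \<sigma> + 1) = length \<pi> + 1 \<and> V (length \<sigma> + 1) = length \<pi> + 1 \<and>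
     (\<forall>x y. (x, y) \<in> points \<sigma> \<longrightarrow> (X x, V y) \<in> points \<pi>)"

text \<open>
  The image in \<open>\<pi>\<close> of a unit square of \<open>\<sigma>\<close>; for the lines of an occurrence \<open>c\<close> it is
  the region of that square with respect to \<open>c\<close>.
\<close>

definition box :: "(nat \<Rightarrow> nat) \<Rightarrow> (nat \<Rightarrow> nat) \<Rightarrow> square \<Rightarrow> (nat \<times> nat) set" where
  "box X V = (\<lambda>(a, b). {X a <..< X (a + 1)} \<times> {V b <..< V (b + 1)})"

definition vacant :: "nat list \<Rightarrow> (nat \<Rightarrow> nat) \<Rightarrow> (nat \<Rightarrow> nat) \<Rightarrow> square set \<Rightarrow> bool" where
  "vacant \<pi> X V S \<longleftrightarrow> (\<forall>s\<in>S. box X V s \<inter> points \<pi> = {})"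

lemma embedding_less:
  assumes "embedding \<sigma> \<pi> X V" "a \<le> length \<sigma> + 1" "b \<le> length \<sigma> + 1"
  shows "X a < X b \<longleftrightarrow> a < b" "V a < V b \<longleftrightarrow> a < b"
  using assms strict_mono_on_less[of "{0..length \<sigma> + 1}" X a b]
    strict_mono_on_less[of "{0..length \<sigma> + 1}" V a b]
  by (auto simp: embedding_def)

lemma embedding_pos:
  assumes "embedding \<sigma> \<pi> X V" "perm_word \<sigma>" "perm_word \<pi>" "v \<in> set \<sigma>"
  shows "pos \<pi> (V v) = X (pos \<sigma> v)"
  using assms pos_in_points[of \<sigma> v] by (intro pos_eq) (auto simp: embedding_def)

lemma xlines_map:
  assumes "embedding \<sigma> \<pi> X V" "perm_word \<sigma>" "perm_word \<pi>" "set c \<subseteq> set \<sigma>"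
  shows "xlines \<pi> (map V c) = map X (xlines \<sigma> c)"
  using assms embedding_pos[OF assms(1-3)] by (auto simp: xlines_def embedding_def)

lemma ylines_map:
  assumes "embedding \<sigma> \<pi> X V" "perm_word \<sigma>" "set c \<subseteq> set \<sigma>"
  shows "ylines \<pi> (map V c) = map V (ylines \<sigma> c)"
proof -
  have "sort (map V c) = map V (sort c)"
  proof (rule sort_map_mono)
    fix x y assume "x \<in> set c" "y \<in> set c" "x \<le> y"
    moreover from this have "x \<le> length \<sigma> + 1" "y \<le> length \<sigma> + 1"
      using assms perm_wordD(1)[OF assms(2)] by fastforce+
    ultimately show "V x \<le> V y"
      using embedding_less(2)[OF assms(1), of y x] by linarith
  qed
  thus ?thesis using assms(1) by (auto simp: ylines_def embedding_def)
qed

lemma lines_range: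
  assumes "perm_word \<sigma>" "set c \<subseteq> set \<sigma>" "i \<le> length c + 1"
  shows "xlines \<sigma> c ! i \<le> length \<sigma> + 1" "ylines \<sigma> c ! i \<le> length \<sigma> + 1"
proof -
  have v: "v \<le> length \<sigma> + 1" "pos \<sigma> v \<le> length \<sigma> + 1" if "v \<in> set c" for v
    using that assms(2) points_range[OF assms(1) pos_in_points[OF assms(1), of v]] by auto
  have "xlines \<sigma> c ! i \<in> set (xlines \<sigma> c)" "ylines \<sigma> c ! i \<in> set (ylines \<sigma> c)"
    using assms(3) by (intro nth_mem; simp add: xlines_def ylines_def)+
  thus "xlines \<sigma> c ! i \<le> length \<sigma> + 1" "ylines \<sigma> c ! i \<le> length \<sigma> + 1"
    using v by (auto simp: xlines_def ylines_def)
qed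

lemma region_map:
  assumes "embedding \<sigma> \<pi> X V" "perm_word \<sigma>" "perm_word \<pi>" "set c \<subseteq> set \<sigma>"
    and "s \<in> grid (length c)"
  shows "region \<pi> (map V c) s = box (\<lambda>i. X (xlines \<sigma> c ! i)) (\<lambda>i. V (ylines \<sigma> c ! i)) s"
proof -
  have "length (xlines \<sigma> c) = length c + 2" "length (ylines \<sigma> c) = length c + 2"
    by (auto simp: xlines_def ylines_def)
  thus ?thesis
    using assms(5) xlines_map[OF assms(1-4)] ylines_map[OF assms(1,2,4)]
    by (auto simp: region_def box_def grid_def)
qed

lemma unit_squares_subset_grid:
  assumes "perm_word \<sigma>" "set c \<subseteq> set \<sigma>" "s \<in> grid (length c)"
  shows "unit_squares \<sigma> c s \<subseteq> grid (length \<sigma>)"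
  using lines_range[OF assms(1,2), of "fst s + 1"] lines_range[OF assms(1,2), of "snd s + 1"] assms(3)
  by (force simp: unit_squares_def grid_def)

lemma interval_index:
  fixes f :: "nat \<Rightarrow> nat"
  assumes "f 0 \<le> x" "x < f (n + 1)"
  obtains i where "i \<le> n" "f i \<le> x" "x < f (i + 1)"
proof -
  have "\<exists>i\<le>n. f i \<le> x \<and> x < f (i + 1)"
    using assms
  proof (induction n)
    case (Suc n)
    show ?case
    proof (cases "x < f (n + 1)")
      case True
      thus ?thesis using Suc.IH[OF Suc.prems(1)] le_SucI by blast
    next
      case False
      thus ?thesis using Suc.prems by (intro exI[of _ "Suc n"]) simp
    qed
  qed simp
  thus thesis using that by blast
qed

text \<open>
  The image in \<open>\<pi>\<close> of a region of \<open>c\<close> is cut by the images of the grid lines of \<open>\<sigma>\<close> into the images of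
  its unit squares. A point of \<open>\<pi>\<close> in it thus lies inside one of these, excluded by vacancy, or on a
  line. The image of a line meets \<open>\<pi>\<close> only in the image of the point of \<open>\<sigma>\<close> on that line, and such a
  point would lie in the region of \<open>c\<close> in \<open>\<sigma>\<close>.
\<close>

lemma region_vacant:
  assumes emb: "embedding \<sigma> \<pi> X V" and perm: "perm_word \<sigma>" "perm_word \<pi>"
    and c: "set c \<subseteq> set \<sigma>" and s: "s \<in> grid (length c)"
    and empty: "region \<sigma> c s \<inter> points \<sigma> = {}"
    and vac: "vacant \<pi> X V (unit_squares \<sigma> c s)"
  shows "region \<pi> (map V c) s \<inter> points \<pi> = {}"
proof (rule ccontr)
  assume "region \<pi> (map V c) s \<inter> points \<pi> \<noteq> {}"
  then obtain x y where xy: "(x, y) \<in> points \<pi>" and reg: "(x, y) \<in> region \<pi> (map V c) s" by auto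
  obtain a b where ab: "s = (a, b)" "a \<le> length c" "b \<le> length c"
    using s by (auto simp: grid_def)
  define u u' v v' where "u = xlines \<sigma> c ! a" and "u' = xlines \<sigma> c ! (a + 1)"
    and "v = ylines \<sigma> c ! b" and "v' = ylines \<sigma> c ! (b + 1)"
  have range: "u \<le> length \<sigma> + 1" "u' \<le> length \<sigma> + 1" "v \<le> length \<sigma> + 1" "v' \<le> length \<sigma> + 1"
    unfolding u_def u'_def v_def v'_def using ab lines_range[OF perm(1) c] by auto
  have in_box: "X u < x" "x < X u'" "V v < y" "y < V v'"
    using reg unfolding region_map[OF emb perm c s]
    by (auto simp: box_def ab u_def u'_def v_def v'_def)
  have embD: "X 0 = 0" "V 0 = 0" "X (length \<sigma> + 1) = length \<pi> + 1" "V (length \<sigma> + 1) = length \<pi> + 1"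
    "\<And>x y. (x, y) \<in> points \<sigma> \<Longrightarrow> (X x, V y) \<in> points \<pi>"
    using emb by (auto simp: embedding_def)
  note less = embedding_less[OF emb]
  \<comment> \<open>The point cannot be the image of a point of \<open>\<sigma>\<close>, which would lie in the empty region.\<close>
  have off: False if p: "(i, j) \<in> points \<sigma>" "X i = x" "V j = y" for i j
  proof -
    have "u < i" "i < u'" "v < j" "j < v'"
      using in_box p points_range[OF perm(1) p(1)] range less[of u i] less[of i u'] less[of v j]
        less[of j v'] by auto
    hence "(i, j) \<in> region \<sigma> c s"
      by (auto simp: region_def ab u_def u'_def v_def v'_def)
    thus False using empty p by auto
  qed
  obtain i where i: "i \<le> length \<sigma>" "X i \<le> x" "x < X (i + 1)"
    using interval_index[of X x "length \<sigma>"] embD points_range[OF perm(2) xy] by auto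
  obtain j where j: "j \<le> length \<sigma>" "V j \<le> y" "y < V (j + 1)"
    using interval_index[of V y "length \<sigma>"] embD points_range[OF perm(2) xy] by auto
  have "X i \<noteq> x"
  proof
    assume eq: "X i = x"
    hence "i \<noteq> 0" using embD points_range[OF perm(2) xy] by (intro notI) simp
    hence p: "(i, \<sigma> ! (i - 1)) \<in> points \<sigma>" using i by (auto simp: in_points_iff)
    hence "(x, V (\<sigma> ! (i - 1))) \<in> points \<pi>" using embD eq by auto
    hence "V (\<sigma> ! (i - 1)) = y" using xy by (auto simp: in_points_iff)
    thus False using off p eq by blast
  qed
  moreover have "V j \<noteq> y"
  proof
    assume eq: "V j = y"
    hence "j \<noteq> 0" using embD points_range[OF perm(2) xy] by (intro notI) simp
    hence "j \<in> set \<sigma>" using j perm_wordD(1)[OF perm(1)] by auto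
    hence p: "(pos \<sigma> j, j) \<in> points \<sigma>" using pos_in_points perm by blast
    hence "X (pos \<sigma> j) = x" using embD eq xy points_inj[OF perm(2)] by blast
    thus False using off p eq by blast
  qed
  ultimately have "(x, y) \<in> box X V (i, j)"
    using i j by (auto simp: box_def)
  moreover have "u \<le> i" "i < u'" "v \<le> j" "j < v'"
    using less[of u "i + 1"] less[of i u'] less[of v "j + 1"] less[of j v'] in_box i j range by auto
  hence "(i, j) \<in> unit_squares \<sigma> c s"
    by (auto simp: unit_squares_def ab u_def u'_def v_def v'_def)
  ultimately show False
    using vac xy by (auto simp: vacant_def)
qed

lemma classical_occ_map:
  assumes emb: "embedding \<sigma> \<pi> X V" and perm: "perm_word \<sigma>" "perm_word \<pi>"
    and occ: "classical_occ \<tau> c \<sigma>"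
  shows "classical_occ \<tau> (map V c) \<pi>"
proof -
  have c: "subseq c \<sigma>" "order_isomorphic c \<tau>" using occ by (auto simp: classical_occ_def)
  note less = embedding_less[OF emb]
  have pt: "(X (Suc i), V (\<sigma> ! i)) \<in> points \<pi>" if "i < length \<sigma>" for i
    using emb that nth_in_points[OF that] by (auto simp: embedding_def)
  let ?js = "map (\<lambda>i. X (Suc i) - 1) [0..<length \<sigma>]"
  \<comment> \<open>The image of the word \<open>\<sigma>\<close> is read off \<open>\<pi>\<close> at increasing indices; these are positions minus 1.\<close>
  have "map V \<sigma> = map ((!) \<pi>) ?js"
    using pt by (intro nth_equalityI) (auto simp: in_points_iff)
  moreover have "subseq (map ((!) \<pi>) ?js) \<pi>"
  proof (rule subseq_map_nth)
    show "sorted_wrt (<) ?js"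
      unfolding sorted_wrt_iff_nth_less
    proof (intro allI impI)
      fix i j assume "i < j" "j < length ?js"
      thus "?js ! i < ?js ! j"
        using less[of "Suc i" "Suc j"] pt[of i] pt[of j] by (auto simp: in_points_iff)
    qed
    show "set ?js \<subseteq> {..<length \<pi>}"
      using pt by (fastforce simp: in_points_iff)
  qed
  ultimately have "subseq (map V c) \<pi>"
    using subseq_map[OF c(1), of V] subseq_order.trans by fastforce
  moreover have "c ! i \<le> length \<sigma> + 1" if "i < length c" for i
  proof -
    have "c ! i \<in> set \<sigma>"
      using that c(1) list_emb_set[of "(=)" c \<sigma> "c ! i"] by (metis nth_mem)
    thus ?thesis using perm_wordD[OF perm(1)] by auto
  qed
  hence "order_isomorphic (map V c) \<tau>"
    using c(2) less by (auto simp: order_isomorphic_def)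
  ultimately show ?thesis by (simp add: classical_occ_def)
qed

lemma classical_occD:
  assumes "classical_occ \<tau> c \<sigma>"
  shows "length c = length \<tau>" "set c \<subseteq> set \<sigma>"
  using assms list_emb_set[of "(=)" c \<sigma>]
  by (auto simp: classical_occ_def order_isomorphic_def)

text \<open>
  Composition of an occurrence in a mesh pattern with an occurrence of that pattern in \<open>\<pi>\<close>. Vacancy is
  only demanded inside the grid of \<open>\<sigma>\<close>, because outside of it the values of \<open>X\<close> and \<open>V\<close> are arbitrary.
\<close>

lemma occ_in_mesh_embedding:
  assumes emb: "embedding \<sigma> \<pi> X V" and perm: "perm_word \<sigma>" "perm_word \<pi>"
    and occ: "occ_in_mesh (\<tau>, S) c (\<sigma>, Y)" and S: "S \<subseteq> grid (length \<tau>)"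
    and vac: "vacant \<pi> X V (Y \<inter> grid (length \<sigma>))"
  shows "occ_in_perm (\<tau>, S) (map V c) \<pi>"
proof -
  have c: "classical_occ \<tau> c \<sigma>" using occ by (simp add: occ_in_mesh_def occ_in_perm_def)
  have "region \<pi> (map V c) s \<inter> points \<pi> = {}" if s: "s \<in> S" for s
  proof (rule region_vacant[OF emb perm])
    show c\<sigma>: "set c \<subseteq> set \<sigma>" using classical_occD[OF c] by simp
    show sg: "s \<in> grid (length c)" using classical_occD[OF c] S s by auto
    show "region \<sigma> c s \<inter> points \<sigma> = {}" using occ s by (simp add: occ_in_mesh_def occ_in_perm_def)
    have "unit_squares \<sigma> c s \<subseteq> Y" using occ s by (auto simp: occ_in_mesh_def)
    thus "vacant \<pi> X V (unit_squares \<sigma> c s)"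
      using vac unit_squares_subset_grid[OF perm(1) c\<sigma> sg] unfolding vacant_def by blast
  qed
  thus ?thesis using classical_occ_map[OF emb perm c] by (simp add: occ_in_perm_def)
qed

section \<open>The embedding given by an occurrence\<close>

text \<open>
  The entry of \<open>c\<close> in the role of the value \<open>v\<close> of \<open>\<tau>\<close> is the \<open>v\<close>-th smallest one, so the horizontal
  lines of \<open>c\<close>, which are obtained by sorting, match the values of \<open>\<tau>\<close>. The reason is that \<open>c\<close> is
  the image of \<open>\<tau>\<close> under a monotone map, which commutes with sorting, and sorting \<open>\<tau>\<close>
  gives \<open>1, \<dots>, k\<close>.
\<close>

lemma sort_nth_order_isomorphic:
  assumes perm: "perm_word \<tau>" and iso: "order_isomorphic c \<tau>" and i: "i < length \<tau>"
  shows "sort c ! (\<tau> ! i - 1) = c ! i"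
proof -
  define f where "f v = c ! (pos \<tau> v - 1)" for v
  have f_nth: "f (\<tau> ! j) = c ! j" if "j < length \<tau>" for j
    using pos_eq[OF perm nth_in_points[OF that]] by (simp add: f_def)
  have "sort c = sort (map f \<tau>)"
    using iso f_nth by (intro arg_cong[where f = sort] nth_equalityI)
      (auto simp: order_isomorphic_def)
  also have "\<dots> = map f (sort \<tau>)"
  proof (rule sort_map_mono)
    fix x y assume "x \<in> set \<tau>" "y \<in> set \<tau>" "x \<le> y"
    then obtain j k where "j < length \<tau>" "k < length \<tau>" "x = \<tau> ! j" "y = \<tau> ! k"
      by (auto simp: in_set_conv_nth)
    thus "f x \<le> f y"
      using iso \<open>x \<le> y\<close> f_nth by (auto simp: order_isomorphic_def) (metis leD linorder_le_less_linear)
  qed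
  finally have "sort c = map f [1..<Suc (length \<tau>)]"
    using sort_perm_word[OF perm] by simp
  moreover have "1 \<le> \<tau> ! i" "\<tau> ! i \<le> length \<tau>"
    using points_range[OF perm nth_in_points[OF i]] by auto
  ultimately show ?thesis using f_nth[OF i] by (simp add: nth_append del: upt_Suc)
qed

text \<open>
  The starting point of the induction: an occurrence \<open>c\<close> of \<open>\<tau>\<close> embeds \<open>\<tau>\<close> by its own lines, and the
  occurrence \<open>\<tau>\<close> of \<open>\<tau>\<close> in itself is sent to \<open>c\<close>.
\<close>

lemma embedding_of_occurrence:
  assumes perm: "perm_word \<tau>" "perm_word \<pi>" and occ: "classical_occ \<tau> c \<pi>"
  shows "embedding \<tau> \<pi> ((!) (xlines \<pi> c)) ((!) (ylines \<pi> c))"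
    and "map ((!) (ylines \<pi> c)) \<tau> = c"
proof -
  have c: "subseq c \<pi>" "order_isomorphic c \<tau>" using occ by (auto simp: classical_occ_def)
  have len: "length c = length \<tau>" and sub: "set c \<subseteq> set \<pi>" using classical_occD[OF occ] by auto
  have strict: "strict_mono_on {0..length \<tau> + 1} ((!) xs)"
    if "sorted_wrt (<) xs" "length xs = length \<tau> + 2" for xs :: "nat list"
    using that by (auto intro!: strict_mono_onI simp: sorted_wrt_iff_nth_less)
  have "map (pos \<pi>) \<pi> = [1..<Suc (length \<pi>)]"
    using pos_eq[OF perm(2) nth_in_points]
    by (intro nth_equalityI) (auto simp del: upt_Suc)
  hence sub_pos: "subseq (map (pos \<pi>) c) [1..<Suc (length \<pi>)]"
    using subseq_map[OF c(1), of "pos \<pi>"] by simp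
  hence inc: "sorted_wrt (<) (map (pos \<pi>) c)"
    using sorted_wrt_subseq[OF sub_pos] sorted_wrt_upt by blast
  have "\<forall>v\<in>set c. 0 < pos \<pi> v \<and> pos \<pi> v < Suc (length \<pi>)"
    using points_range[OF perm(2) pos_in_points[OF perm(2)]] sub by fastforce
  hence xs: "sorted_wrt (<) (xlines \<pi> c)"
    using inc by (auto simp: xlines_def sorted_wrt_append)
  have "distinct c" using inc by (simp add: strict_sorted_iff distinct_map)
  moreover have "\<forall>v\<in>set c. 0 < v \<and> v < Suc (length \<pi>)"
    using sub perm_wordD(1)[OF perm(2)] by fastforce
  ultimately have ys: "sorted_wrt (<) (ylines \<pi> c)"
    by (auto simp: ylines_def sorted_wrt_append strict_sorted_iff)
  have y_nth: "ylines \<pi> c ! (\<tau> ! i) = c ! i" if i: "i < length \<tau>" for i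
  proof -
    have "1 \<le> \<tau> ! i" "\<tau> ! i \<le> length \<tau>"
      using points_range[OF perm(1) nth_in_points[OF i]] by auto
    hence "ylines \<pi> c ! (\<tau> ! i) = sort c ! (\<tau> ! i - 1)"
      using len by (auto simp: ylines_def nth_Cons nth_append split: nat.splits)
    thus ?thesis using sort_nth_order_isomorphic[OF perm(1) c(2) i] by simp
  qed
  thus "map ((!) (ylines \<pi> c)) \<tau> = c"
    using len by (intro nth_equalityI) auto
  have "(xlines \<pi> c ! x, ylines \<pi> c ! y) \<in> points \<pi>" if xy: "(x, y) \<in> points \<tau>" for x y
  proof -
    obtain i where i: "x = Suc i" "i < length \<tau>" "y = \<tau> ! i"
      using xy by (cases x) (auto simp: in_points_iff)
    have "xlines \<pi> c ! x = pos \<pi> (c ! i)"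
      using i len by (simp add: xlines_def nth_append)
    thus ?thesis
      using i len y_nth[OF i(2)] pos_in_points[OF perm(2), of "c ! i"] sub by (simp add: subset_iff)
  qed
  thus "embedding \<tau> \<pi> ((!) (xlines \<pi> c)) ((!) (ylines \<pi> c))"
    unfolding embedding_def using strict[OF xs] strict[OF ys] len
    by (auto simp: xlines_def ylines_def nth_append)
qed

section \<open>Adding a point\<close>

text \<open>
  The line map after a new line at \<open>x\<close> has been drawn between the lines \<open>i\<close> and \<open>i + 1\<close>; the same
  definition serves both directions.
\<close>

definition insert_line :: "(nat \<Rightarrow> nat) \<Rightarrow> nat \<Rightarrow> nat \<Rightarrow> nat \<Rightarrow> nat" where
  "insert_line X i x a = (if a = i + 1 then x else X (collapse i a))"

lemma insert_line_bump: "insert_line V j y (bump j v) = V v"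
  by (auto simp: insert_line_def bump_def collapse_def)

lemma insert_line_strict_mono:
  assumes "strict_mono_on {0..n + 1} X" "i \<le> n" "X i < x" "x < X (i + 1)"
  shows "strict_mono_on {0..n + 2} (insert_line X i x)"
proof (rule strict_mono_onI)
  fix a b assume ab: "a \<in> {0..n + 2}" "b \<in> {0..n + 2}" "a < (b::nat)"
  have less: "X k < X l \<longleftrightarrow> k < l" if "k \<le> n + 1" "l \<le> n + 1" for k l
    using strict_mono_on_less[OF assms(1)] that by auto
  have le: "X k \<le> X l" if "k \<le> l" "l \<le> n + 1" for k l
    using less[of l k] that by linarith
  consider "a = i + 1" "b \<ge> i + 2" | "b = i + 1" "a \<le> i" | "a \<noteq> i + 1" "b \<noteq> i + 1"
    using ab by linarith
  thus "insert_line X i x a < insert_line X i x b"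
  proof cases
    case 1
    moreover have "X (i + 1) \<le> X (b - 1)" using 1 ab by (intro le) auto
    ultimately show ?thesis using assms(4) by (auto simp: insert_line_def collapse_def)
  next
    case 2
    thus ?thesis using assms(2-4) ab le[of a i] by (auto simp: insert_line_def collapse_def)
  next
    case 3
    thus ?thesis using assms(2) ab less by (auto simp: insert_line_def collapse_def)
  qed
qed

text \<open>
  The old strip between lines \<open>i\<close> and \<open>i + 1\<close> is split into two; all other strips are kept. Hence
  vacancy of the old squares passes to the new squares that collapse to them.
\<close>

lemma insert_line_interval:
  assumes "X i \<le> x" "x \<le> X (i + 1)"
  shows "{insert_line X i x a <..< insert_line X i x (a + 1)} \<subseteq>
    {X (collapse i a) <..< X (collapse i a + 1)}"
  using assms by (cases "a < i"; cases "a = i"; cases "a = i + 1")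
    (auto simp: insert_line_def collapse_def)

lemma length_insert_point: "i \<le> length \<sigma> \<Longrightarrow> length (insert_point \<sigma> (i, j)) = length \<sigma> + 1"
  by (simp add: insert_point_def)

text \<open>
  Up to the order of its entries, the new word consists of \<open>j + 1\<close> and the image of \<open>\<sigma>\<close> under
  \<open>bump j\<close>, an injection that misses exactly the value \<open>j + 1\<close>. So its entries are distinct, and a
  count shows that they exhaust \<open>1, \<dots>, n + 1\<close>.
\<close>

lemma perm_word_insert_point:
  assumes "perm_word \<sigma>" "i \<le> length \<sigma>" "j \<le> length \<sigma>"
  shows "perm_word (insert_point \<sigma> (i, j))"
proof -
  note \<sigma> = perm_wordD[OF assms(1)]
  have inj: "inj (bump j)" by (auto simp: inj_def bump_def split: if_splits)
  have gap: "j + 1 \<notin> range (bump j)" by (auto simp: bump_def)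
  have "mset (insert_point \<sigma> (i, j)) = mset ((j + 1) # map (bump j) (take i \<sigma> @ drop i \<sigma>))"
    unfolding insert_point_def by (simp only: map_append) simp
  hence ms: "mset (insert_point \<sigma> (i, j)) = mset ((j + 1) # map (bump j) \<sigma>)" by simp
  have d: "distinct (insert_point \<sigma> (i, j))"
    using mset_eq_imp_distinct_iff[OF ms] \<sigma>(2) inj gap
    by (auto simp: distinct_map inj_on_def inj_def)
  have "set (insert_point \<sigma> (i, j)) \<subseteq> {1..length \<sigma> + 1}"
    using mset_eq_setD[OF ms] \<sigma>(1) assms(3) by (auto simp: bump_def)
  moreover have "card (set (insert_point \<sigma> (i, j))) = length \<sigma> + 1"
    using distinct_card[OF d] length_insert_point[OF assms(2)] by simp
  ultimately have "set (insert_point \<sigma> (i, j)) = {1..length \<sigma> + 1}"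
    by (intro card_subset_eq) auto
  thus ?thesis using d length_insert_point[OF assms(2)] by (auto simp: permutations_of_set_def)
qed

lemma points_insert_point:
  assumes "i \<le> length \<sigma>" "(x, y) \<in> points (insert_point \<sigma> (i, j))"
  shows "x = i + 1 \<and> y = j + 1 \<or> (\<exists>v. (collapse i x, v) \<in> points \<sigma> \<and> x \<noteq> i + 1 \<and> y = bump j v)"
proof -
  have x: "1 \<le> x" "x \<le> length \<sigma> + 1" and y: "y = insert_point \<sigma> (i, j) ! (x - 1)"
    using assms by (auto simp: in_points_iff length_insert_point)
  consider "x = i + 1" | "x \<le> i" | "x > i + 1" by linarith
  thus ?thesis
  proof cases
    case 1
    thus ?thesis using assms(1) y by (simp add: insert_point_def nth_append)
  next
    case 2
    thus ?thesis using assms(1) x y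
      by (auto simp: insert_point_def nth_append in_points_iff collapse_def)
  next
    case 3
    define z where "z = x - i - 2"
    have z: "x = i + 2 + z" using 3 by (simp add: z_def)
    hence "y = bump j (\<sigma> ! (i + z))"
      using assms(1) x y by (simp add: insert_point_def nth_append)
    thus ?thesis using z x by (auto simp: in_points_iff collapse_def)
  qed
qed

lemma embedding_insert_point:
  assumes emb: "embedding \<sigma> \<pi> X V" and ij: "i \<le> length \<sigma>" "j \<le> length \<sigma>"
    and xy: "(x, y) \<in> box X V (i, j)" "(x, y) \<in> points \<pi>"
  shows "embedding (insert_point \<sigma> (i, j)) \<pi> (insert_line X i x) (insert_line V j y)"
proof -
  have "(insert_line X i x a, insert_line V j y b) \<in> points \<pi>"
    if "(a, b) \<in> points (insert_point \<sigma> (i, j))" for a b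
    using points_insert_point[OF ij(1) that] xy(2) emb
    by (auto simp: insert_line_bump embedding_def) (simp_all add: insert_line_def)
  thus ?thesis
    using emb ij xy(1) insert_line_strict_mono[of "length \<sigma>" X i x]
      insert_line_strict_mono[of "length \<sigma>" V j y]
    by (auto simp: embedding_def length_insert_point box_def)
      (auto simp: insert_line_def collapse_def)
qed

text \<open>
  How far a point lies in direction \<open>a\<close>. Treating the four directions through one linear
  functional lets a single maximal point do for all of them.
\<close>

definition height :: "dir \<Rightarrow> nat \<times> nat \<Rightarrow> int" where
  "height a = (\<lambda>(x, y). case a of
     Upward \<Rightarrow> int y | Downward \<Rightarrow> - int y | Leftward \<Rightarrow> - int x | Rightward \<Rightarrow> int x)"

text \<open>
  The two newly shaded squares form the part of the old square that lies beyond the new point in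
  direction \<open>a\<close>, so they are empty if the new point is furthest in this direction. All other shaded
  squares collapse to shaded ones.
\<close>

lemma vacant_add_point:
  assumes ij: "i \<le> length \<sigma>" "j \<le> length \<sigma>"
    and xy: "(x, y) \<in> box X V (i, j)"
    and top: "\<And>z. z \<in> box X V (i, j) \<inter> points \<pi> \<Longrightarrow> height a z \<le> height a (x, y)"
    and vac: "vacant \<pi> X V (Y \<inter> grid (length \<sigma>))"
    and add: "add_point (\<sigma>, Y) (i, j) a = (\<sigma>', Y')"
  shows "vacant \<pi> (insert_line X i x) (insert_line V j y) (Y' \<inter> grid (length \<sigma>'))"
proof -
  let ?X = "insert_line X i x" and ?V = "insert_line V j y"
  have sub: "box ?X ?V (k, l) \<subseteq> box X V (collapse i k, collapse j l)" for k l
    using insert_line_interval[of X i x k] insert_line_interval[of V j y l] xy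
    by (auto simp: box_def dest!: subsetD)
  have "box ?X ?V (k, l) \<inter> points \<pi> = {}"
    if kl: "(k, l) \<in> Y'" "k \<le> length \<sigma> + 1" "l \<le> length \<sigma> + 1" for k l
  proof (cases "(k, l) \<in> dir_shading (i, j) a")
    case True
    have coll: "collapse i k = i" "collapse j l = j"
      using True by (auto simp: dir_shading_def collapse_def split: dir.splits)
    show ?thesis
    proof (rule ccontr)
      assume "box ?X ?V (k, l) \<inter> points \<pi> \<noteq> {}"
      then obtain x' y' where z: "(x', y') \<in> box ?X ?V (k, l)" "(x', y') \<in> points \<pi>" by auto
      hence "height a (x', y') \<le> height a (x, y)" using sub[of k l] top coll by auto
      thus False using True z(1)
        by (auto simp: dir_shading_def height_def box_def insert_line_def collapse_def
            split: dir.splits)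
    qed
  next
    case False
    hence "(collapse i k, collapse j l) \<in> Y"
      using add kl(1) by (auto simp: add_point_def)
    moreover have "(collapse i k, collapse j l) \<in> grid (length \<sigma>)"
      using kl ij by (auto simp: grid_def collapse_def)
    ultimately show ?thesis using vac sub[of k l] unfolding vacant_def by blast
  qed
  moreover have "length \<sigma>' = length \<sigma> + 1"
    using add length_insert_point[OF ij(1)] by (auto simp: add_point_def)
  ultimately show ?thesis unfolding vacant_def by (fastforce simp: grid_def)
qed

text \<open>
  A vacant embedding extends over an added point in any direction as soon as the square has a point in
  \<open>\<pi>\<close>: the furthest one is taken. The updated occurrence keeps its image in \<open>\<pi>\<close>, which is what keeps
  the comparison with the strongest occurrence meaningful throughout the recursion.
\<close>

lemma embedding_add_point:
  assumes emb: "embedding \<sigma> \<pi> X V" and perm: "perm_word \<sigma>"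
    and vac: "vacant \<pi> X V (Y \<inter> grid (length \<sigma>))"
    and s: "s \<in> grid (length \<sigma>)" and ne: "box X V s \<inter> points \<pi> \<noteq> {}"
    and add: "add_point (\<sigma>, Y) s a = (\<sigma>', Y')"
  obtains X' V' where "embedding \<sigma>' \<pi> X' V'" "perm_word \<sigma>'"
    "vacant \<pi> X' V' (Y' \<inter> grid (length \<sigma>'))" "\<And>c. map V' (UpdO c s) = map V c"
    "\<And>c. set c \<subseteq> set \<sigma> \<Longrightarrow> set (UpdO c s) \<subseteq> set \<sigma>'"
proof -
  obtain i j where ij: "s = (i, j)" "i \<le> length \<sigma>" "j \<le> length \<sigma>"
    using s by (auto simp: grid_def)
  let ?B = "box X V s \<inter> points \<pi>"
  have fin: "finite ?B" using finite_points by blast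
  obtain z where z: "z \<in> ?B" "\<And>z'. z' \<in> ?B \<Longrightarrow> height a z' \<le> height a z"
    using obtains_MAX[OF fin ne, of "height a"] Max_ge[of "height a ` ?B"] fin
    by (metis finite_imageI imageI)
  obtain x y where xy: "z = (x, y)" by (cases z)
  have \<sigma>': "\<sigma>' = insert_point \<sigma> (i, j)" using add ij by (simp add: add_point_def)
  show thesis
  proof
    show "embedding \<sigma>' \<pi> (insert_line X i x) (insert_line V j y)"
      using embedding_insert_point[OF emb ij(2,3)] z xy ij \<sigma>' by auto
    show "perm_word \<sigma>'" using perm_word_insert_point[OF perm ij(2,3)] \<sigma>' by simp
    show "vacant \<pi> (insert_line X i x) (insert_line V j y) (Y' \<inter> grid (length \<sigma>'))"
      by (rule vacant_add_point[OF ij(2,3)]) (use z xy ij vac add in auto)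
    show "map (insert_line V j y) (UpdO c s) = map V c" for c
      by (simp add: UpdO_def ij insert_line_bump)
    have "bump j ` set \<sigma> = bump j ` (set (take i \<sigma>) \<union> set (drop i \<sigma>))"
      by (metis append_take_drop_id set_append)
    thus "set (UpdO c s) \<subseteq> set \<sigma>'" if "set c \<subseteq> set \<sigma>" for c
      using image_mono[OF that, of "bump j"]
      by (auto simp: UpdO_def ij \<sigma>' insert_point_def image_Un)
  qed
qed

section \<open>Strength\<close>

lemma weaker_Nil [simp]: "\<not> weaker [] []"
  by (simp add: weaker_def)

lemma weaker_Cons [simp]: "weaker (x # s) (y # t) \<longleftrightarrow> x < y \<or> x = y \<and> weaker s t"
  by (auto simp: weaker_def)

text \<open>
  Each component of the strength is a position or a value, up to sign, and an embedding preserves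
  strict order and equality of both. So the first component in which two strengths differ stays the
  first one, with the same sign of the difference.
\<close>

lemma weaker_strength_map:
  assumes emb: "embedding \<sigma> \<pi> X V" and perm: "perm_word \<sigma>" "perm_word \<pi>" "perm_word \<tau>"
    and F: "set (map fst F) \<subseteq> set \<tau>"
    and c: "set c \<subseteq> set \<sigma>" "length c = length \<tau>"
    and c': "set c' \<subseteq> set \<sigma>" "length c' = length \<tau>"
    and "weaker (strength \<tau> F \<sigma> c) (strength \<tau> F \<sigma> c')"
  shows "weaker (strength \<tau> F \<pi> (map V c)) (strength \<tau> F \<pi> (map V c'))"
  using F assms(10)
proof (induction F)
  case Nil
  thus ?case by (simp add: strength_def)
next
  case (Cons f F)
  obtain v a where f: "f = (v, a)" by (cases f)
  define e e' where "e = c ! (pos \<tau> v - 1)" and "e' = c' ! (pos \<tau> v - 1)"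
  have "pos \<tau> v - 1 < length \<tau>"
    using Cons.prems(1) f points_range[OF perm(3) pos_in_points[OF perm(3), of v]] by auto
  hence V: "map V c ! (pos \<tau> v - 1) = V e" "map V c' ! (pos \<tau> v - 1) = V e'"
    and e: "e \<in> set \<sigma>" "e' \<in> set \<sigma>"
    using c c' by (auto simp: e_def e'_def)
  have pts: "(pos \<sigma> e, e) \<in> points \<sigma>" "(pos \<sigma> e', e') \<in> points \<sigma>"
    using e pos_in_points[OF perm(1)] by auto
  note range = points_range[OF perm(1) pts(1)] points_range[OF perm(1) pts(2)]
  have less: "V e < V e' \<longleftrightarrow> e < e'" "V e' < V e \<longleftrightarrow> e' < e"
    "X (pos \<sigma> e) < X (pos \<sigma> e') \<longleftrightarrow> pos \<sigma> e < pos \<sigma> e'"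
    "X (pos \<sigma> e') < X (pos \<sigma> e) \<longleftrightarrow> pos \<sigma> e' < pos \<sigma> e"
    using range embedding_less[OF emb] by auto
  have eq: "pos \<sigma> e = pos \<sigma> e' \<longleftrightarrow> e = e'"
    using pts by (auto simp: in_points_iff)
  define g where "g \<rho> w = (case a of Upward \<Rightarrow> int w | Downward \<Rightarrow> - int w
      | Leftward \<Rightarrow> - int (pos \<rho> w) | Rightward \<Rightarrow> int (pos \<rho> w))" for \<rho> w
  have str: "strength \<tau> (f # F) \<rho> b = g \<rho> (b ! (pos \<tau> v - 1)) # strength \<tau> F \<rho> b" for \<rho> b
    by (simp add: strength_def f g_def Let_def)
  have Xpos: "pos \<pi> (V e) = X (pos \<sigma> e)" "pos \<pi> (V e') = X (pos \<sigma> e')"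
    using embedding_pos[OF emb perm(1,2)] e by auto
  have "g \<sigma> e < g \<sigma> e' \<longleftrightarrow> g \<pi> (V e) < g \<pi> (V e')"
    by (cases a) (simp_all add: g_def Xpos less)
  moreover have "g \<sigma> e = g \<sigma> e' \<Longrightarrow> g \<pi> (V e) = g \<pi> (V e')"
    by (cases a) (auto simp: g_def eq)
  moreover have "weaker (g \<sigma> e # strength \<tau> F \<sigma> c) (g \<sigma> e' # strength \<tau> F \<sigma> c')"
    using Cons.prems(2) unfolding str e_def e'_def .
  moreover have "weaker (strength \<tau> F \<pi> (map V c)) (strength \<tau> F \<pi> (map V c'))"
    if "weaker (strength \<tau> F \<sigma> c) (strength \<tau> F \<sigma> c')"
    using Cons.IH that Cons.prems(1) by simp
  ultimately show ?case
    unfolding str V by auto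
qed

lemma exists_strongest:
  assumes "finite A" "A \<noteq> {}"
  shows "\<exists>c\<in>A. \<forall>c'\<in>A. \<not> weaker (f c) (f c')"
proof -
  have tr: "trans {(x, y). x < (y::int)}" by (auto simp: trans_def)
  have irr: "\<not> weaker s s" for s
    by (induction s) auto
  have trw: "weaker s u" if "weaker s t" "weaker t u" for s t u
    using lexord_trans[OF _ _ tr] that unfolding weaker_def by blast
  have "\<exists>m\<in>A. \<forall>x\<in>A. x \<noteq> m \<longrightarrow> \<not> weaker (f m) (f x)"
  proof (rule Finite_Set.bex_max_element[OF assms(1)])
    show "asymp_on A (\<lambda>x y. weaker (f x) (f y))"
      using irr trw by (blast intro: asymp_onI)
    show "transp_on A (\<lambda>x y. weaker (f x) (f y))"
      using trw by (blast intro: transp_onI)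
  qed (rule assms(2))
  thus ?thesis using irr by metis
qed

section \<open>Soundness\<close>

text \<open>
  Whether a square can be shaded does not depend on the other squares, so the maximal shading
  consists of all squares that can be shaded on their own.
\<close>

lemma max_shading_eq:
  assumes "classical_occ \<tau> c \<sigma>"
  shows "max_shading \<tau> c (\<sigma>, Y) =
    {s \<in> grid (length \<tau>). region \<sigma> c s \<inter> points \<sigma> = {} \<and> unit_squares \<sigma> c s \<subseteq> Y}"
  unfolding max_shading_def
  by (rule Greatest_equality) (use assms in \<open>auto simp: occ_in_mesh_def occ_in_perm_def\<close>)

text \<open>
  The invariant of the recursion. Only the image \<open>c0\<close> of \<open>c\<close> in \<open>\<pi>\<close> has to be maximal in strength;
  as it does not change when points are added, maximality is a fixed hypothesis, while \<open>\<sigma>\<close>, \<open>Y\<close>, \<open>c\<close>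
  and the embedding vary in the induction.
\<close>

lemma SA_sound:
  assumes \<pi>: "perm_word \<pi>" and \<tau>: "perm_word \<tau>"
    and R: "R \<subseteq> grid (length \<tau>)" and R': "R' \<subseteq> grid (length \<tau>)"
    and F: "set (map fst F) \<subseteq> set \<tau>"
    and strongest: "\<And>c. occ_in_perm (\<tau>, R) c \<pi> \<Longrightarrow> \<not> weaker (strength \<tau> F \<pi> c0) (strength \<tau> F \<pi> c)"
    and "length c0 = length \<tau>"
    and "SA \<tau> R R' F (\<sigma>, Y) c F' d = Success"
    and "perm_word \<sigma>" and "embedding \<sigma> \<pi> X V" and "vacant \<pi> X V (Y \<inter> grid (length \<sigma>))"
    and "set c \<subseteq> set \<sigma>" and "map V c = c0"
  shows "contains_mesh \<pi> (\<tau>, R')"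
  using assms(8-)
proof (induction d arbitrary: \<sigma> Y c F' X V rule: less_induct)
  case (less d)
  note \<sigma> = less.prems(2) and emb = less.prems(3) and vac = less.prems(4)
  have len: "length c = length \<tau>" using less.prems(6) assms(7) by (metis length_map)
  from less.prems(1) obtain c' where c': "classical_occ \<tau> c' \<sigma>"
    and alt: "let T = max_shading \<tau> c' (\<sigma>, Y) in
            R \<subseteq> T \<and> weaker (strength \<tau> F \<sigma> c) (strength \<tau> F \<sigma> c')
          \<or> R' \<subseteq> T
          \<or> (case d of 0 \<Rightarrow> False | Suc d' \<Rightarrow>
               (\<forall>s\<in>R' - T. region \<sigma> c' s \<inter> points \<sigma> = {}) \<and>
               (\<exists>ss. distinct ss \<and> set ss = (\<Union>s\<in>R' - T. unit_squares \<sigma> c' s) - Y \<and>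
                  (\<forall>i<length ss. \<exists>a.
                     SA \<tau> R R' F (add_point (\<sigma>, Y \<union> set (take i ss)) (ss ! i) a)
                       (UpdO c (ss ! i)) (UpdF F' (ss ! i)) d' = Success)))"
    by (subst (asm) SA.simps) (auto split: if_splits)
  note c'D = classical_occD[OF c']
  define T where "T = max_shading \<tau> c' (\<sigma>, Y)"
  have in_T: "s \<in> T \<longleftrightarrow> s \<in> grid (length \<tau>) \<and> region \<sigma> c' s \<inter> points \<sigma> = {} \<and> unit_squares \<sigma> c' s \<subseteq> Y" for s
    unfolding T_def max_shading_eq[OF c'] by simp
  have occ: "occ_in_perm (\<tau>, S) (map V c') \<pi>" if "S \<subseteq> T" for S
  proof (rule occ_in_mesh_embedding[OF emb \<sigma> \<pi> _ _ vac])
    show "occ_in_mesh (\<tau>, S) c' (\<sigma>, Y)"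
      using that c' in_T by (fastforce simp: occ_in_mesh_def occ_in_perm_def)
    show "S \<subseteq> grid (length \<tau>)" using that in_T by auto
  qed
  from alt consider "R \<subseteq> T" "weaker (strength \<tau> F \<sigma> c) (strength \<tau> F \<sigma> c')" | "R' \<subseteq> T"
    | d' ss where "d = Suc d'" "\<forall>s\<in>R' - T. region \<sigma> c' s \<inter> points \<sigma> = {}"
      "set ss = (\<Union>s\<in>R' - T. unit_squares \<sigma> c' s) - Y"
      "\<forall>i<length ss. \<exists>a. SA \<tau> R R' F (add_point (\<sigma>, Y \<union> set (take i ss)) (ss ! i) a)
                       (UpdO c (ss ! i)) (UpdF F' (ss ! i)) d' = Success"
    unfolding T_def[symmetric] Let_def by (auto split: nat.splits)
  thus ?case
  proof cases
    case 1
    have "weaker (strength \<tau> F \<pi> (map V c)) (strength \<tau> F \<pi> (map V c'))"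
      by (rule weaker_strength_map[OF emb \<sigma> \<pi> \<tau> F less.prems(5) len c'D(2,1) 1(2)])
    thus ?thesis using strongest[OF occ[OF 1(1)]] less.prems(6) by simp
  next
    case 2
    thus ?thesis using occ by (auto simp: contains_mesh_def)
  next
    case 3
    have grid: "set ss \<subseteq> grid (length \<sigma>)"
      using 3(3) R' unit_squares_subset_grid[OF \<sigma> c'D(2)] c'D(1) by fastforce
    show ?thesis
    \<comment> \<open>Either all squares in question are empty in \<open>\<pi>\<close>, or there is a first one that is not.\<close>
    proof (cases "\<exists>i<length ss. box X V (ss ! i) \<inter> points \<pi> \<noteq> {}")
      case False
      hence "vacant \<pi> X V (set ss)" unfolding vacant_def by (metis in_set_conv_nth)
      hence "vacant \<pi> X V ((Y \<union> set ss) \<inter> grid (length \<sigma>))"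
        using vac by (auto simp: vacant_def)
      moreover have "occ_in_mesh (\<tau>, R') c' (\<sigma>, Y \<union> set ss)"
      proof -
        have "region \<sigma> c' s \<inter> points \<sigma> = {} \<and> unit_squares \<sigma> c' s \<subseteq> Y \<union> set ss"
          if "s \<in> R'" for s
        proof (cases "s \<in> T")
          case True
          thus ?thesis using in_T by blast
        next
          case False
          thus ?thesis using 3(2,3) that by blast
        qed
        thus ?thesis using c' by (simp add: occ_in_mesh_def occ_in_perm_def)
      qed
      ultimately show ?thesis
        using occ_in_mesh_embedding[OF emb \<sigma> \<pi> _ R'] by (auto simp: contains_mesh_def)
    next
      case True
      define P where "P i \<longleftrightarrow> i < length ss \<and> box X V (ss ! i) \<inter> points \<pi> \<noteq> {}" for i
      obtain i where "P i" and least: "\<And>k. k < i \<Longrightarrow> \<not> P k"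
        using True exists_least_iff[of P] unfolding P_def by blast
      hence i: "i < length ss" "box X V (ss ! i) \<inter> points \<pi> \<noteq> {}"
        and first: "\<And>k. k < i \<Longrightarrow> box X V (ss ! k) \<inter> points \<pi> = {}"
        unfolding P_def by (blast intro: order.strict_trans)+
      have vac_i: "vacant \<pi> X V ((Y \<union> set (take i ss)) \<inter> grid (length \<sigma>))"
      proof -
        have "box X V z \<inter> points \<pi> = {}" if z: "z \<in> set (take i ss)" for z
        proof -
          obtain k where "k < i" "z = ss ! k"
            using z by (auto simp: in_set_conv_nth)
          thus ?thesis using first by simp
        qed
        thus ?thesis using vac unfolding vacant_def by blast
      qed
      obtain a where SA: "SA \<tau> R R' F (add_point (\<sigma>, Y \<union> set (take i ss)) (ss ! i) a)
                       (UpdO c (ss ! i)) (UpdF F' (ss ! i)) d' = Success"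
        using 3(4) i(1) by blast
      obtain \<sigma>' Y' where add: "add_point (\<sigma>, Y \<union> set (take i ss)) (ss ! i) a = (\<sigma>', Y')"
        by fastforce
      have s: "ss ! i \<in> grid (length \<sigma>)" using grid i(1) by auto
      obtain X' V' where "embedding \<sigma>' \<pi> X' V'" "perm_word \<sigma>'"
        "vacant \<pi> X' V' (Y' \<inter> grid (length \<sigma>'))" "map V' (UpdO c (ss ! i)) = map V c"
        "set (UpdO c (ss ! i)) \<subseteq> set \<sigma>'"
        using embedding_add_point[OF emb \<sigma> vac_i s i(2) add] less.prems(5) by metis
      thus ?thesis
        using less.IH[of d' \<sigma>' Y' "UpdO c (ss ! i)" "UpdF F' (ss ! i)" X' V'] SA add 3(1) less.prems(6)
        by simp
    qed
  qed
qed

theorem theorem3p3: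
  fixes \<tau> :: "nat list" and R R' :: "square set" and d :: nat
  assumes "mesh_pattern (\<tau>, R)"
    and "mesh_pattern (\<tau>, R')"
    and "\<exists>F. force_on \<tau> F \<and> shading_algorithm \<tau> R R' F d = Success"
  shows "\<forall>n. \<forall>\<pi>\<in>permutations_of_set {1..n}.
           contains_mesh \<pi> (\<tau>, R) \<longrightarrow> contains_mesh \<pi> (\<tau>, R')"
proof (intro allI ballI impI)
  fix n \<pi> assume n: "\<pi> \<in> permutations_of_set {1..n}" and "contains_mesh \<pi> (\<tau>, R)"
  have \<pi>: "perm_word \<pi>" using n length_finite_permutations_of_set[OF n] by simp
  have \<tau>: "perm_word \<tau>" and R: "R \<subseteq> grid (length \<tau>)" and R': "R' \<subseteq> grid (length \<tau>)"
    using assms(1,2) by (auto simp: mesh_pattern_def)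
  obtain F where F: "set (map fst F) \<subseteq> set \<tau>" and SA: "SA \<tau> R R' F (\<tau>, R) \<tau> F d = Success"
    using assms(3) by (auto simp: force_on_def shading_algorithm_def)
  let ?A = "{c. occ_in_perm (\<tau>, R) c \<pi>}"
  have "?A \<subseteq> set (subseqs \<pi>)" by (auto simp: occ_in_perm_def classical_occ_def)
  hence "finite ?A" by (rule finite_subset) simp
  moreover have "?A \<noteq> {}" using \<open>contains_mesh \<pi> (\<tau>, R)\<close> by (auto simp: contains_mesh_def)
  ultimately obtain c0 where c0: "occ_in_perm (\<tau>, R) c0 \<pi>"
    and strongest: "\<And>c. occ_in_perm (\<tau>, R) c \<pi> \<Longrightarrow> \<not> weaker (strength \<tau> F \<pi> c0) (strength \<tau> F \<pi> c)"
    using exists_strongest[of ?A "strength \<tau> F \<pi>"] by blast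
  have occ: "classical_occ \<tau> c0 \<pi>" using c0 by (simp add: occ_in_perm_def)
  have "vacant \<pi> ((!) (xlines \<pi> c0)) ((!) (ylines \<pi> c0)) R"
    using c0 by (auto simp: vacant_def occ_in_perm_def box_def region_def)
  hence vac: "vacant \<pi> ((!) (xlines \<pi> c0)) ((!) (ylines \<pi> c0)) (R \<inter> grid (length \<tau>))"
    by (auto simp: vacant_def)
  show "contains_mesh \<pi> (\<tau>, R')"
    by (rule SA_sound[OF \<pi> \<tau> R R' F strongest classical_occD(1)[OF occ] SA \<tau>
          embedding_of_occurrence(1)[OF \<tau> \<pi> occ] vac order.refl
          embedding_of_occurrence(2)[OF \<tau> \<pi> occ]])
qed

end
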